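(* For all integers $k,t\ge 0$ with $k+t\ge 1$, $.M.(5k,9k+12t)\le 14k+11t-2$.
   Context: $.M.(m,n)$ is Knuth's unconstrained restricted-adversary function, defined for integers $m,n\ge0$ as follows (special case $\lambda=\rho=.$ of a family $\lambda M\rho$). Consider sorted lists $a_1<\cdots<a_m$ and $b_1<\cdots<b_n$ (all elements distinct, interleaving unknown). Left constraint $\lambda$: "." none, "$\backslash$" known $a_1<b_1$, "/" known $a_1>b_1$; right constraint $\rho$: "." none, "$\backslash$" known $a_m<b_n$, "/" known $a_m>b_n$; a constraint on a problem with an empty list is vacuous; $\lambda M\rho(m,n)$ is defined when some interleaving satisfies the constraints. Its value is $0$ if the constraints determine the interleaving (in particular if $m=0$ or $n=0$); otherwise $\lambda M\rho(m,n)=\min_{i,j}\lambda M_{i,j}\rho(m,n)$ with $\lambda M_{i,j}\rho(m,n)=1+\max$ over admissible splittings for the comparison $a_i$ vs $b_j$ of the sum of the two subproblem values. Splittings: (S) $0\le p\le m$, $0\le q\le n$, subproblems $(a_1..a_p;b_1..b_q)$ below $(a_{p+1}..a_m;b_{q+1}..b_n)$, values $\lambda M.(p,q)+.M\rho(m-p,n-q)$; (A) $1\le k\le m$, $1\le q\le n-1$, $b_q<a_k<b_{q+1}$, subproblems $(a_1..a_k;b_1..b_q)$ and $(a_k..a_m;b_{q+1}..b_n)$, values $\lambda M/(k,q)+\backslash M\rho(m-k+1,n-q)$; (B) $1\le p\le m-1$, $1\le l\le n$, $a_p<b_l<a_{p+1}$, subproblems $(a_1..a_p;b_1..b_l)$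 and $(a_{p+1}..a_m;b_l..b_n)$, values $\lambda M\backslash(p,l)+/M\rho(m-p,n-l+1)$. A splitting is admissible if $a_i$ and $b_j$ lie in different subproblems (neither is the shared element) and some interleaving satisfies the splitting's relations together with $\lambda,\rho$. *)

theory Defs
  imports Main
begin

text \<open>
  An interleaving of \<open>a\<^sub>1 < \<dots> < a\<^sub>m\<close> and \<open>b\<^sub>1 < \<dots> < b\<^sub>n\<close> is given by the ranks of the elements in the
  merged list: \<open>as ! (i - 1)\<close> is the rank of \<open>a\<^sub>i\<close> and \<open>bs ! (j - 1)\<close> that of \<open>b\<^sub>j\<close>.
\<close>

definition interleavings :: "nat \<Rightarrow> nat \<Rightarrow> (nat list \<times> nat list) set" where
  "interleavings m n = {(as, bs). length as = m \<and> length bs = n \<and>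
     sorted_wrt (<) as \<and> sorted_wrt (<) bs \<and>
     set as \<inter> set bs = {} \<and> set as \<union> set bs = {..<m + n}}"

text \<open>
  The three possible constraints: nothing is known, the \<open>a\<close>-element is smaller than the
  \<open>b\<close>-element, the \<open>a\<close>-element is greater than the \<open>b\<close>-element.
\<close>

datatype constraint = Free | Less | Greater

fun holds :: "constraint \<Rightarrow> nat \<Rightarrow> nat \<Rightarrow> bool" where
  "holds Free a b \<longleftrightarrow> True"
| "holds Less a b \<longleftrightarrow> a < b"
| "holds Greater a b \<longleftrightarrow> a > b"

definition consistent ::
    "constraint \<Rightarrow> nat \<Rightarrow> nat \<Rightarrow> constraint \<Rightarrow> (nat list \<times> nat list) set" where
  "consistent lc m n rc = {(as, bs) \<in> interleavings m n.
     as \<noteq> [] \<and> bs \<noteq> [] \<longrightarrow> holds lc (hd as) (hd bs) \<and> holds rc (last as) (last bs)}"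

text \<open>
  \<open>Simple p q\<close> cuts between \<open>a\<^sub>1..a\<^sub>p; b\<^sub>1..b\<^sub>q\<close> and the rest; \<open>SharedA k q\<close> puts \<open>a\<^sub>k\<close> into both
  subproblems, with \<open>b\<^sub>q < a\<^sub>k < b\<^sub>q\<^sub>+\<^sub>1\<close>; \<open>SharedB p l\<close> puts \<open>b\<^sub>l\<close> into both, with
  \<open>a\<^sub>p < b\<^sub>l < a\<^sub>p\<^sub>+\<^sub>1\<close>.
\<close>

datatype splitting = Simple nat nat | SharedA nat nat | SharedB nat nat

fun in_range :: "nat \<Rightarrow> nat \<Rightarrow> splitting \<Rightarrow> bool" where
  "in_range m n (Simple p q) \<longleftrightarrow> p \<le> m \<and> q \<le> n"
| "in_range m n (SharedA k q) \<longleftrightarrow> 1 \<le> k \<and> k \<le> m \<and> 1 \<le> q \<and> q \<le> n - 1"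
| "in_range m n (SharedB p l) \<longleftrightarrow> 1 \<le> p \<and> p \<le> m - 1 \<and> 1 \<le> l \<and> l \<le> n"

fun relations :: "splitting \<Rightarrow> nat list \<times> nat list \<Rightarrow> bool" where
  "relations (Simple p q) (as, bs) \<longleftrightarrow>
     (\<forall>x \<in> set (take p as) \<union> set (take q bs). \<forall>y \<in> set (drop p as) \<union> set (drop q bs). x < y)"
| "relations (SharedA k q) (as, bs) \<longleftrightarrow> bs ! (q - 1) < as ! (k - 1) \<and> as ! (k - 1) < bs ! q"
| "relations (SharedB p l) (as, bs) \<longleftrightarrow> as ! (p - 1) < bs ! (l - 1) \<and> bs ! (l - 1) < as ! p"

text \<open>
  \<open>separates i j s\<close>: \<open>a\<^sub>i\<close> and \<open>b\<^sub>j\<close> lie in different subproblems of \<open>s\<close> and neither of them is shared.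
\<close>

fun separates :: "nat \<Rightarrow> nat \<Rightarrow> splitting \<Rightarrow> bool" where
  "separates i j (Simple p q) \<longleftrightarrow> i \<le> p \<and> q < j \<or> p < i \<and> j \<le> q"
| "separates i j (SharedA k q) \<longleftrightarrow> i < k \<and> q < j \<or> k < i \<and> j \<le> q"
| "separates i j (SharedB p l) \<longleftrightarrow> i \<le> p \<and> l < j \<or> p < i \<and> j < l"

definition admissible ::
    "constraint \<Rightarrow> nat \<Rightarrow> nat \<Rightarrow> constraint \<Rightarrow> nat \<Rightarrow> nat \<Rightarrow> splitting set" where
  "admissible lc m n rc i j = {s. in_range m n s \<and> separates i j s \<and>
     (\<exists>x \<in> consistent lc m n rc. relations s x)}"

text \<open>
  \<open>M lc m n rc\<close> is the restricted adversary function with left constraint \<open>lc\<close> and right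
  constraint \<open>rc\<close>.  If no interleaving satisfies the constraints, the function is not defined
  mathematically; it is then given the dummy value \<open>0\<close>.  This value is never used in the recursion,
  since the subproblems of an admissible splitting have consistent constraints.
\<close>

function M :: "constraint \<Rightarrow> nat \<Rightarrow> nat \<Rightarrow> constraint \<Rightarrow> nat" where
  "M lc m n rc =
    (if \<exists>\<^sub>\<le>\<^sub>1 x. x \<in> consistent lc m n rc then 0
     else MIN i \<in> {1..m}. MIN j \<in> {1..n}. 1 + (MAX s \<in> admissible lc m n rc i j.
       (case s of
          Simple p q \<Rightarrow> M lc p q Free + M Free (m - p) (n - q) rc
        | SharedA k q \<Rightarrow> M lc k q Greater + M Less (m - k + 1) (n - q) rc
        | SharedB p l \<Rightarrow> M lc p l Less + M Greater (m - p) (n - l + 1) rc)))"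
  by pat_completeness auto
termination
  by (relation "measure (\<lambda>(lc, m, n, rc). m + n)") (auto simp: admissible_def)

declare M.simps [simp del]

end

theory Submission
  imports Defs
begin

text \<open>
  A constraint at an end of the lists merely places one extremal element of the merged list, so the
  problem behaves like an unconstrained one in which that element is deleted.  With \<open>m'\<close> and \<open>n'\<close>
  the sizes after these deletions, the two subproblems of any splitting have reduced sizes that add
  up to at most \<open>(m', n')\<close>.  Always comparing the first remaining \<open>a\<close> with the second
  remaining \<open>b\<close> (with the first one if \<open>n' = 1\<close>) then yields the bound \<open>m' + \<lfloor>(m' + n') / 2\<rfloor>\<close>,
  and \<open>5k + \<lfloor>(14k + 12t) / 2\<rfloor> = 12k + 6t \<le> 14k + 11t - 2\<close>.
\<close>

section \<open>Reduced sizes and the bounding function\<close>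

text \<open>\<open>Less\<close> on the left makes the first \<open>a\<close> the overall minimum,
  and \<open>Greater\<close> on the right makes the last \<open>a\<close> the overall maximum. The
  subtraction is truncated, so additivity over a splitting has to exclude boundary cases in which a
  list is too short for its deletions.\<close>

definition reduced_a :: "constraint \<Rightarrow> nat \<Rightarrow> constraint \<Rightarrow> nat" where
  "reduced_a lc m rc = m - of_bool (lc = Less) - of_bool (rc = Greater)"

definition reduced_b :: "constraint \<Rightarrow> nat \<Rightarrow> constraint \<Rightarrow> nat" where
  "reduced_b lc n rc = n - of_bool (lc = Greater) - of_bool (rc = Less)"

text \<open>The value \<open>m\<close> at \<open>n = 1\<close> is the cost of testing the single
  \<open>b\<close> against the \<open>a\<close>s one after another. It is kept below the general
  formula because a splitting may leave exactly one \<open>b\<close> in the lower part: with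
  \<open>m + (m + 1) div 2\<close> there, the strict decrease could fail.\<close>

definition cost_bound :: "nat \<Rightarrow> nat \<Rightarrow> nat" where
  "cost_bound m n = (if m = 0 \<or> n = 0 then 0 else if n = 1 then m else m + (m + n) div 2)"

lemma cost_bound_mono:
  assumes "m \<le> m'" "n \<le> n'"
  shows "cost_bound m n \<le> cost_bound m' n'"
  using assms unfolding cost_bound_def by auto

text \<open>The last hypothesis lists the two outcomes of the comparison: the lower part has some
  \<open>a\<close> but fewer than \<open>min n 2\<close> of the \<open>b\<close>s, or no
  \<open>a\<close> and at least that many \<open>b\<close>s. If \<open>q = 0\<close>, the lower part
  is free and the upper one loses an \<open>a\<close>. If \<open>q = 1 < n\<close>, the lower part
  costs exactly \<open>p\<close>, while the sum under the halving drops by at least two. If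
  \<open>p = 0\<close>, the lower part is free and the upper one loses two \<open>b\<close>s, or the
  only one.\<close>

lemma cost_bound_split:
  assumes "1 \<le> m" "1 \<le> n" "p + p' \<le> m" "q + q' \<le> n"
    and "1 \<le> p \<and> q < min n 2 \<or> p = 0 \<and> min n 2 \<le> q"
  shows "cost_bound p q + cost_bound p' q' < cost_bound m n"
proof -
  have "cost_bound p' q' \<le> cost_bound (m - p) (n - q)"
    using assms by (intro cost_bound_mono) auto
  moreover have "cost_bound p q + cost_bound (m - p) (n - q) < cost_bound m n"
  proof -
    have "p \<le> m" "q \<le> n" using assms by auto
    consider "1 \<le> p" "q = 0" | "1 \<le> p" "q = 1" "2 \<le> n" | "p = 0" "min n 2 \<le> q"
      using assms by linarith
    then show ?thesis
      using \<open>p \<le> m\<close> \<open>q \<le> n\<close> assms(1,2) unfolding cost_bound_def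
      by cases (auto split: if_splits)
  qed
  ultimately show ?thesis by simp
qed

section \<open>Ranks in an interleaving, and when constraints determine it\<close>

lemma hd_le_of_sorted:
  fixes xs :: "nat list"
  assumes "sorted_wrt (<) xs" "x \<in> set xs"
  shows "hd xs \<le> x"
  using assms by (cases xs) auto

lemma last_ge_of_sorted:
  fixes xs :: "nat list"
  assumes "sorted_wrt (<) xs" "x \<in> set xs"
  shows "x \<le> last xs"
  using assms by (cases xs rule: rev_cases) (auto simp: sorted_wrt_append)

lemma interleavings_swap:
  "(as, bs) \<in> interleavings m n \<longleftrightarrow> (bs, as) \<in> interleavings n m"
  unfolding interleavings_def by (auto simp: add.commute)

lemma interleavings_unique:
  assumes "(as, bs) \<in> interleavings m n" "(as, bs') \<in> interleavings m n"
  shows "bs = bs'"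
proof -
  have "set bs = {..<m + n} - set as" "set bs' = {..<m + n} - set as"
    using assms unfolding interleavings_def by auto
  moreover have "sorted_wrt (<) bs" "sorted_wrt (<) bs'"
    using assms unfolding interleavings_def by auto
  ultimately show ?thesis by (metis strict_sorted_equal)
qed

text \<open>Rank 0 occurs in one of the lists, necessarily at its head. This turns a left constraint
  into a known rank; the next lemma does the same at the right end.\<close>

lemma hd_interleaving:
  assumes "(as, bs) \<in> interleavings m n" "as \<noteq> []" "bs \<noteq> []" "hd as < hd bs"
  shows "hd as = 0"
proof -
  have "0 \<in> set as \<union> set bs"
    using assms unfolding interleavings_def by (auto simp flip: length_greater_0_conv)
  moreover have "sorted_wrt (<) as" "sorted_wrt (<) bs"
    using assms unfolding interleavings_def by auto
  ultimately have "hd as \<le> 0 \<or> hd bs \<le> 0"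
    using hd_le_of_sorted by blast
  then show ?thesis using assms(4) by auto
qed

lemma last_interleaving:
  assumes "(as, bs) \<in> interleavings m n" "as \<noteq> []" "bs \<noteq> []" "last bs < last as"
  shows "last as = m + n - 1"
proof -
  have "m + n - 1 \<in> {..<m + n}"
    using assms unfolding interleavings_def by (auto simp flip: length_greater_0_conv)
  then have "m + n - 1 \<in> set as \<union> set bs"
    using assms unfolding interleavings_def by auto
  moreover have "sorted_wrt (<) as" "sorted_wrt (<) bs"
    using assms unfolding interleavings_def by auto
  ultimately have "m + n - 1 \<le> last as \<or> m + n - 1 \<le> last bs"
    using last_ge_of_sorted by blast
  then have "m + n - 1 \<le> last as" using assms(4) by auto
  moreover have "last as \<in> {..<m + n}"
    using assms(1,2) unfolding interleavings_def by auto
  ultimately show ?thesis by auto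
qed

text \<open>The flags \<open>l\<close> and \<open>r\<close> say that the first, respectively last,
  element of \<open>as\<close> is extremal overall. With no more elements than flags, every rank is
  forced. The right-hand side does not mention \<open>as\<close>, so two such lists can be compared
  through it. For \<open>m = 1\<close> with both flags the hypotheses contradict each other, so
  giving \<open>l\<close> precedence is safe.\<close>

lemma interleaving_determined:
  assumes "(as, bs) \<in> interleavings m n" "bs \<noteq> []"
    and "m \<le> of_bool l + of_bool r"
    and "as \<noteq> [] \<Longrightarrow> l \<Longrightarrow> hd as < hd bs" "as \<noteq> [] \<Longrightarrow> r \<Longrightarrow> last bs < last as"
  shows "as = (if m = 0 then [] else if m = 2 then [0, m + n - 1] else if l then [0] else [m + n - 1])"
proof -
  have len: "length as = m" using assms unfolding interleavings_def by auto
  have h: "hd as = 0" if "as \<noteq> []" l using assms that hd_interleaving by blast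
  have e: "last as = m + n - 1" if "as \<noteq> []" r using assms that last_interleaving by blast
  have "m = 0 \<or> m = 1 \<or> m = 2" using assms(3) by (cases l; cases r) auto
  then consider "m = 0" | "m = 1" | "m = 2" by blast
  then show ?thesis
  proof cases
    case 1 then show ?thesis using len by simp
  next
    case 2
    then obtain x where "as = [x]" using len by (auto simp: length_Suc_conv)
    then show ?thesis using 2 h e assms(3) by (cases l; cases r) auto
  next
    case 3
    then obtain x y where "as = [x, y]" using len by (auto simp: numeral_2_eq_2 length_Suc_conv)
    then show ?thesis using 3 h e assms(3) by (cases l; cases r) auto
  qed
qed

text \<open>When a reduced size vanishes, the constraints fix all ranks of that list, and the other
  list fills the remaining ranks. By contraposition, both reduced sizes are positive whenever a
  comparison has to be made.\<close>

lemma consistent_unique: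
  assumes "reduced_a lc m rc = 0 \<or> reduced_b lc n rc = 0"
  shows "\<exists>\<^sub>\<le>\<^sub>1 x. x \<in> consistent lc m n rc"
proof -
  have "(as, bs) = (as', bs')"
    if x: "(as, bs) \<in> consistent lc m n rc" "(as', bs') \<in> consistent lc m n rc" for as bs as' bs'
  proof -
    have i: "(as, bs) \<in> interleavings m n" "(as', bs') \<in> interleavings m n"
      using x unfolding consistent_def by auto
    have len: "length as = m" "length as' = m" "length bs = n" "length bs' = n"
      using i unfolding interleavings_def by auto
    have "as = as' \<or> bs = bs'"
    \<comment> \<open>Constraints are vacuous when a list is empty, so this case cannot use them;
      the empty list itself is what coincides.\<close>
    proof (cases "m = 0 \<or> n = 0")
      case True
      then show ?thesis using len by auto
    next
      case False
      then have ne: "as \<noteq> []" "as' \<noteq> []" "bs \<noteq> []" "bs' \<noteq> []" using len by auto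
      from assms show ?thesis
      proof
        assume "reduced_a lc m rc = 0"
        then have m: "m \<le> of_bool (lc = Less) + of_bool (rc = Greater)"
          unfolding reduced_a_def by simp
        have "as = (if m = 0 then [] else if m = 2 then [0, m + n - 1]
            else if lc = Less then [0] else [m + n - 1])"
          using x ne unfolding consistent_def by (intro interleaving_determined[OF i(1) ne(3) m]) auto
        moreover have "as' = (if m = 0 then [] else if m = 2 then [0, m + n - 1]
            else if lc = Less then [0] else [m + n - 1])"
          using x ne unfolding consistent_def by (intro interleaving_determined[OF i(2) ne(4) m]) auto
        ultimately show ?thesis by metis
      next
        assume "reduced_b lc n rc = 0"
        then have n: "n \<le> of_bool (lc = Greater) + of_bool (rc = Less)"
          unfolding reduced_b_def by simp
        note i' = i[THEN iffD1[OF interleavings_swap]]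
        have "bs = (if n = 0 then [] else if n = 2 then [0, n + m - 1]
            else if lc = Greater then [0] else [n + m - 1])"
          using x ne unfolding consistent_def by (intro interleaving_determined[OF i'(1) ne(1) n]) auto
        moreover have "bs' = (if n = 0 then [] else if n = 2 then [0, n + m - 1]
            else if lc = Greater then [0] else [n + m - 1])"
          using x ne unfolding consistent_def by (intro interleaving_determined[OF i'(2) ne(2) n]) auto
        ultimately show ?thesis by metis
      qed
    qed
    then show ?thesis
      using i i[THEN iffD1[OF interleavings_swap]] interleavings_unique by blast
  qed
  then show ?thesis unfolding Uniq_def by auto
qed

section \<open>Finiteness and existence of admissible splittings\<close>

lemma finite_admissible: "finite (admissible lc m n rc i j)"
proof (rule finite_subset)
  show "admissible lc m n rc i j \<subseteq> case_prod Simple ` ({..m} \<times> {..n}) \<union>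
      case_prod SharedA ` ({..m} \<times> {..n}) \<union> case_prod SharedB ` ({..m} \<times> {..n})"
  proof
    fix s assume "s \<in> admissible lc m n rc i j"
    then show "s \<in> case_prod Simple ` ({..m} \<times> {..n}) \<union>
        case_prod SharedA ` ({..m} \<times> {..n}) \<union> case_prod SharedB ` ({..m} \<times> {..n})"
      by (cases s) (auto simp: admissible_def image_iff)
  qed
qed auto

lemma sorted_threshold:
  fixes xs :: "nat list"
  assumes "sorted_wrt (<) xs"
  obtains p where "p \<le> length xs" "\<forall>x \<in> set (take p xs). x < c" "\<forall>x \<in> set (drop p xs). c \<le> x"
proof
  let ?p = "length (takeWhile (\<lambda>x. x < c) xs)"
  show "?p \<le> length xs" by (rule length_takeWhile_le)
  show "\<forall>x \<in> set (take ?p xs). x < c"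
    by (metis set_takeWhileD takeWhile_eq_take)
  have "sorted xs" using assms by (simp add: strict_sorted_iff)
  show "\<forall>x \<in> set (drop ?p xs). c \<le> x"
  proof
    fix x assume x: "x \<in> set (drop ?p xs)"
    show "c \<le> x"
    proof (cases "dropWhile (\<lambda>x. x < c) xs")
      case Nil
      then show ?thesis using x by (metis dropWhile_eq_drop empty_iff list.set(1))
    next
      case (Cons y ys)
      moreover have "\<not> y < c" using Cons hd_dropWhile[of "\<lambda>x. x < c" xs] by auto
      moreover have "sorted (y # ys)" using \<open>sorted xs\<close> Cons by (metis sorted_dropWhile)
      ultimately show ?thesis using x by (auto simp flip: dropWhile_eq_drop)
    qed
  qed
qed

text \<open>\<^const>\<open>Max\<close> is unspecified on the empty set, so the recursion for \<^const>\<open>M\<close> needs this.\<close>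

lemma admissible_nonempty:
  assumes x: "(as, bs) \<in> consistent lc m n rc" and ij: "1 \<le> i" "i \<le> m" "1 \<le> j" "j \<le> n"
  shows "admissible lc m n rc i j \<noteq> {}"
proof -
  have s: "length as = m" "length bs = n" "sorted_wrt (<) as" "sorted_wrt (<) bs"
    "set as \<inter> set bs = {}"
    using x unfolding consistent_def interleavings_def by auto
  \<comment> \<open>Cutting the merged list just below the larger of the two compared elements
    leaves the smaller one in the lower part and the larger one in the upper part.\<close>
  define c where "c = max (as ! (i - 1)) (bs ! (j - 1))"
  obtain p where p: "p \<le> length as" "\<forall>x \<in> set (take p as). x < c" "\<forall>x \<in> set (drop p as). c \<le> x"
    using sorted_threshold[OF s(3)] by blast
  obtain q where q: "q \<le> length bs" "\<forall>x \<in> set (take q bs). x < c" "\<forall>x \<in> set (drop q bs). c \<le> x"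
    using sorted_threshold[OF s(4)] by blast
  have ne: "as ! (i - 1) \<noteq> bs ! (j - 1)"
  proof -
    have "as ! (i - 1) \<in> set as" "bs ! (j - 1) \<in> set bs" using s ij by auto
    then show ?thesis using s(5) by auto
  qed
  have low_a: "i \<le> p \<longleftrightarrow> as ! (i - 1) < c"
  proof (cases "i \<le> p")
    case True
    then have "as ! (i - 1) \<in> set (take p as)"
      using ij s p by (auto simp: in_set_conv_nth intro!: exI[of _ "i - 1"])
    then show ?thesis using True p by auto
  next
    case False
    then have "as ! (i - 1) \<in> set (drop p as)"
      using ij s p by (auto simp: in_set_conv_nth intro!: exI[of _ "i - 1 - p"])
    then show ?thesis using False p by auto
  qed
  have low_b: "j \<le> q \<longleftrightarrow> bs ! (j - 1) < c"
  proof (cases "j \<le> q")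
    case True
    then have "bs ! (j - 1) \<in> set (take q bs)"
      using ij s q by (auto simp: in_set_conv_nth intro!: exI[of _ "j - 1"])
    then show ?thesis using True q by auto
  next
    case False
    then have "bs ! (j - 1) \<in> set (drop q bs)"
      using ij s q by (auto simp: in_set_conv_nth intro!: exI[of _ "j - 1 - q"])
    then show ?thesis using False q by auto
  qed
  have "separates i j (Simple p q)"
    using low_a low_b ne unfolding c_def by auto
  moreover have "relations (Simple p q) (as, bs)"
    using p(2,3) q(2,3) by (simp add: ball_Un) (meson less_le_trans)
  moreover have "in_range m n (Simple p q)"
    using p(1) q(1) s(1,2) by simp
  ultimately have "Simple p q \<in> admissible lc m n rc i j"
    using x unfolding admissible_def by blast
  then show ?thesis by auto
qed

section \<open>Boundary restrictions imposed by the constraints\<close>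

text \<open>A nonempty lower part contains the overall minimum and a nonempty upper part the overall
  maximum; a constraint tells which list that element belongs to.\<close>

lemma admissible_SimpleD:
  assumes "Simple p q \<in> admissible lc m n rc i j" "1 \<le> m" "1 \<le> n"
  shows "lc = Less \<Longrightarrow> p = 0 \<Longrightarrow> q = 0" "lc = Greater \<Longrightarrow> q = 0 \<Longrightarrow> p = 0"
    "rc = Less \<Longrightarrow> q = n \<Longrightarrow> p = m" "rc = Greater \<Longrightarrow> p = m \<Longrightarrow> q = n"
proof -
  obtain as bs where x: "(as, bs) \<in> consistent lc m n rc" and r: "relations (Simple p q) (as, bs)"
    and pq: "p \<le> m" "q \<le> n"
    using assms unfolding admissible_def by auto
  have len: "length as = m" "length bs = n" using x unfolding consistent_def interleavings_def by auto
  then have ne: "as \<noteq> []" "bs \<noteq> []" using assms by auto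
  have h: "holds lc (hd as) (hd bs)" "holds rc (last as) (last bs)"
    using x ne unfolding consistent_def by auto
  have first: "hd ys \<in> set (take k ys)" if "ys \<noteq> []" "0 < k" for k and ys :: "nat list"
    using that by (cases ys; cases k) auto
  have final: "last ys \<in> set (drop k ys)" if "k < length ys" for k and ys :: "nat list"
    using that by (metis drop_eq_Nil last_drop last_in_set not_le)
  show "q = 0" if "lc = Less" "p = 0"
  proof (rule ccontr)
    assume "q \<noteq> 0"
    then have "hd bs < hd as" using first[of bs q] r that ne by auto
    then show False using h that by auto
  qed
  show "p = 0" if "lc = Greater" "q = 0"
  proof (rule ccontr)
    assume "p \<noteq> 0"
    then have "hd as < hd bs" using first[of as p] r that ne by auto
    then show False using h that by auto
  qed
  show "p = m" if "rc = Less" "q = n"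
  proof (rule ccontr)
    assume "p \<noteq> m"
    then have "last bs < last as" using final[of p as] r that ne pq len by auto
    then show False using h that by auto
  qed
  show "q = n" if "rc = Greater" "p = m"
  proof (rule ccontr)
    assume "q \<noteq> n"
    then have "last as < last bs" using final[of q bs] r that ne pq len by auto
    then show False using h that by auto
  qed
qed

text \<open>The shared \<open>a\<close> has a \<open>b\<close> on either side, so it cannot be the
  extremal element named by a constraint.\<close>

lemma admissible_SharedAD:
  assumes "SharedA k q \<in> admissible lc m n rc i j"
  shows "lc = Less \<Longrightarrow> k \<noteq> 1" "rc = Greater \<Longrightarrow> k \<noteq> m"
proof -
  obtain as bs where x: "(as, bs) \<in> consistent lc m n rc"
    and r: "bs ! (q - 1) < as ! (k - 1)" "as ! (k - 1) < bs ! q"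
    and kq: "1 \<le> k" "k \<le> m" "1 \<le> q" "q \<le> n - 1"
    using assms unfolding admissible_def by auto
  have s: "length as = m" "length bs = n" "sorted_wrt (<) as" "sorted_wrt (<) bs"
    using x unfolding consistent_def interleavings_def by auto
  then have ne: "as \<noteq> []" "bs \<noteq> []" using kq by auto
  have h: "holds lc (hd as) (hd bs)" "holds rc (last as) (last bs)"
    using x ne unfolding consistent_def by auto
  show "k \<noteq> 1" if "lc = Less"
  proof
    assume "k = 1"
    moreover have "hd bs \<le> bs ! (q - 1)" using kq s by (intro hd_le_of_sorted) auto
    ultimately show False using that h r ne by (auto simp: hd_conv_nth)
  qed
  show "k \<noteq> m" if "rc = Greater"
  proof
    assume "k = m"
    moreover have "bs ! q \<le> last bs" using kq s by (intro last_ge_of_sorted) auto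
    ultimately show False using that h r s ne by (auto simp: last_conv_nth)
  qed
qed

text \<open>Mirror image of the previous argument: the shared \<open>b\<close> lies between two
  \<open>a\<close>s.\<close>

lemma admissible_SharedBD:
  assumes "SharedB p l \<in> admissible lc m n rc i j"
  shows "lc = Greater \<Longrightarrow> l \<noteq> 1" "rc = Less \<Longrightarrow> l \<noteq> n"
proof -
  obtain as bs where x: "(as, bs) \<in> consistent lc m n rc"
    and r: "as ! (p - 1) < bs ! (l - 1)" "bs ! (l - 1) < as ! p"
    and pl: "1 \<le> p" "p \<le> m - 1" "1 \<le> l" "l \<le> n"
    using assms unfolding admissible_def by auto
  have s: "length as = m" "length bs = n" "sorted_wrt (<) as" "sorted_wrt (<) bs"
    using x unfolding consistent_def interleavings_def by auto
  then have ne: "as \<noteq> []" "bs \<noteq> []" using pl by auto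
  have h: "holds lc (hd as) (hd bs)" "holds rc (last as) (last bs)"
    using x ne unfolding consistent_def by auto
  show "l \<noteq> 1" if "lc = Greater"
  proof
    assume "l = 1"
    moreover have "hd as \<le> as ! (p - 1)" using pl s by (intro hd_le_of_sorted) auto
    ultimately show False using that h r ne by (auto simp: hd_conv_nth)
  qed
  show "l \<noteq> n" if "rc = Less"
  proof
    assume "l = n"
    moreover have "as ! p \<le> last as" using pl s by (intro last_ge_of_sorted) auto
    ultimately show False using that h r s ne by (auto simp: last_conv_nth)
  qed
qed

section \<open>The comparison strategy and the inductive bound\<close>

text \<open>One good pair \<open>i\<close>, \<open>j\<close> bounds the double minimum, and the
  strict bound on each splitting absorbs the \<open>1 +\<close>. Lack of uniqueness supplies a
  consistent interleaving, so the maximum ranges over a nonempty set.\<close>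

lemma M_le_comparison:
  assumes "\<not> (\<exists>\<^sub>\<le>\<^sub>1 x. x \<in> consistent lc m n rc)" "i \<in> {1..m}" "j \<in> {1..n}"
    and "\<And>s. s \<in> admissible lc m n rc i j \<Longrightarrow>
      (case s of
          Simple p q \<Rightarrow> M lc p q Free + M Free (m - p) (n - q) rc
        | SharedA k q \<Rightarrow> M lc k q Greater + M Less (m - k + 1) (n - q) rc
        | SharedB p l \<Rightarrow> M lc p l Less + M Greater (m - p) (n - l + 1) rc) < c"
  shows "M lc m n rc \<le> c"
proof -
  define v where "v s = (case s of
          Simple p q \<Rightarrow> M lc p q Free + M Free (m - p) (n - q) rc
        | SharedA k q \<Rightarrow> M lc k q Greater + M Less (m - k + 1) (n - q) rc
        | SharedB p l \<Rightarrow> M lc p l Less + M Greater (m - p) (n - l + 1) rc)" for s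
  obtain as bs where "(as, bs) \<in> consistent lc m n rc"
    using assms(1) unfolding Uniq_def by auto
  then have "admissible lc m n rc i j \<noteq> {}"
    using admissible_nonempty assms(2,3) by auto
  then have "(MAX s \<in> admissible lc m n rc i j. v s) < c"
    using assms(4) finite_admissible by (subst Max_less_iff) (auto simp: v_def)
  moreover have "M lc m n rc = (MIN i \<in> {1..m}. MIN j \<in> {1..n}. 1 + (MAX s \<in> admissible lc m n rc i j. v s))"
    using assms(1) unfolding v_def by (subst M.simps) simp
  moreover have "\<dots> \<le> (MIN j \<in> {1..n}. 1 + (MAX s \<in> admissible lc m n rc i j. v s))"
    using assms(2) by (intro Min_le) auto
  moreover have "\<dots> \<le> 1 + (MAX s \<in> admissible lc m n rc i j. v s)"
    using assms(3) by (intro Min_le) auto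
  ultimately show ?thesis by linarith
qed

text \<open>The constraints must be arbitrary in the induction, since shared elements create
  constrained subproblems even when the original problem is free.\<close>

lemma M_le_cost_bound: "M lc m n rc \<le> cost_bound (reduced_a lc m rc) (reduced_b lc n rc)"
proof (induction "m + n" arbitrary: lc m n rc rule: less_induct)
  case less
  show ?case
  proof (cases "\<exists>\<^sub>\<le>\<^sub>1 x. x \<in> consistent lc m n rc")
    case True
    then show ?thesis by (subst M.simps) simp
  next
    case False
    let ?m = "reduced_a lc m rc" and ?n = "reduced_b lc n rc"
    have pos: "1 \<le> ?m" "1 \<le> ?n"
      using False consistent_unique[of lc m rc n] by linarith+
    then have mn: "1 \<le> m" "1 \<le> n" unfolding reduced_a_def reduced_b_def by auto
    \<comment> \<open>Indices refer to the full lists, so \<open>i\<close> and \<open>j\<close> are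
      shifted by one when the first \<open>a\<close> or the first \<open>b\<close> is already known
      to be the minimum.\<close>
    define i :: nat where "i = 1 + of_bool (lc = Less)"
    define c where "c = min ?n 2"
    define j where "j = c + of_bool (lc = Greater)"
    have c: "1 \<le> c" using pos unfolding c_def by simp
    have ij: "i \<in> {1..m}" "j \<in> {1..n}"
      using pos unfolding i_def j_def c_def reduced_a_def reduced_b_def by auto
    show ?thesis
    proof (rule M_le_comparison[OF False ij])
      fix s assume s: "s \<in> admissible lc m n rc i j"
      then have sep: "separates i j s" and range: "in_range m n s" unfolding admissible_def by auto
      show "(case s of
          Simple p q \<Rightarrow> M lc p q Free + M Free (m - p) (n - q) rc
        | SharedA k q \<Rightarrow> M lc k q Greater + M Less (m - k + 1) (n - q) rc
        | SharedB p l \<Rightarrow> M lc p l Less + M Greater (m - p) (n - l + 1) rc) < cost_bound ?m ?n"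
      proof (cases s)
        case (Simple p q)
        have pq: "i \<le> p \<and> q < j \<or> p < i \<and> j \<le> q" "p \<le> m" "q \<le> n"
          using sep range Simple by auto
        \<comment> \<open>The compared elements lie in different parts, so neither part is empty;
          this rules out the degenerate cases left open by
          \<open>admissible_SimpleD\<close>.\<close>
        have edges: "lc = Less \<Longrightarrow> 0 < p" "lc = Greater \<Longrightarrow> 0 < q"
            "rc = Less \<Longrightarrow> q < n" "rc = Greater \<Longrightarrow> p < m"
          using admissible_SimpleD[OF s[unfolded Simple] mn] pq ij by fastforce+
        have "M lc p q Free \<le> cost_bound (reduced_a lc p Free) (reduced_b lc q Free)"
          using Simple sep range ij by (intro less) auto
        moreover have "M Free (m - p) (n - q) rc \<le>
            cost_bound (reduced_a Free (m - p) rc) (reduced_b Free (n - q) rc)"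
          using Simple sep range ij by (intro less) auto
        moreover have "cost_bound (reduced_a lc p Free) (reduced_b lc q Free) +
            cost_bound (reduced_a Free (m - p) rc) (reduced_b Free (n - q) rc) < cost_bound ?m ?n"
        proof (rule cost_bound_split[OF pos])
          show "reduced_a lc p Free + reduced_a Free (m - p) rc \<le> ?m"
            using edges range Simple unfolding reduced_a_def by (auto simp: of_bool_def)
          show "reduced_b lc q Free + reduced_b Free (n - q) rc \<le> ?n"
            using edges range Simple unfolding reduced_b_def by (auto simp: of_bool_def)
          show "1 \<le> reduced_a lc p Free \<and> reduced_b lc q Free < min ?n 2 \<or>
              reduced_a lc p Free = 0 \<and> min ?n 2 \<le> reduced_b lc q Free"
            using edges sep c Simple unfolding i_def j_def c_def[symmetric]
            by (auto simp: reduced_a_def reduced_b_def of_bool_def split: if_splits)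
        qed
        ultimately show ?thesis using Simple by simp
      next
        case (SharedA k q)
        have edges: "lc = Less \<Longrightarrow> 1 < k" "rc = Greater \<Longrightarrow> k < m"
          using admissible_SharedAD[OF s[unfolded SharedA]] range SharedA by fastforce+
        have "M lc k q Greater \<le> cost_bound (reduced_a lc k Greater) (reduced_b lc q Greater)"
          using SharedA range by (intro less) auto
        moreover have "M Less (m - k + 1) (n - q) rc \<le>
            cost_bound (reduced_a Less (m - k + 1) rc) (reduced_b Less (n - q) rc)"
          using SharedA range by (intro less) auto
        moreover have "cost_bound (reduced_a lc k Greater) (reduced_b lc q Greater) +
            cost_bound (reduced_a Less (m - k + 1) rc) (reduced_b Less (n - q) rc) < cost_bound ?m ?n"
        proof (rule cost_bound_split[OF pos])
          \<comment> \<open>The shared \<open>a\<close> is maximal below and minimal above, hence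
            deleted on both sides: the sizes \<open>k\<close> and \<open>m - k + 1\<close> add up to
            \<open>m + 1\<close>, and the reduced ones to \<open>?m - 1\<close>.\<close>
          show "reduced_a lc k Greater + reduced_a Less (m - k + 1) rc \<le> ?m"
            using edges range SharedA unfolding reduced_a_def by (auto simp: of_bool_def)
          show "reduced_b lc q Greater + reduced_b Less (n - q) rc \<le> ?n"
            using edges range SharedA unfolding reduced_b_def by (auto simp: of_bool_def)
          show "1 \<le> reduced_a lc k Greater \<and> reduced_b lc q Greater < min ?n 2 \<or>
              reduced_a lc k Greater = 0 \<and> min ?n 2 \<le> reduced_b lc q Greater"
            using edges sep c SharedA unfolding i_def j_def c_def[symmetric]
            by (auto simp: reduced_a_def reduced_b_def of_bool_def split: if_splits)
        qed
        ultimately show ?thesis using SharedA by simp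
      next
        case (SharedB p l)
        have edges: "lc = Greater \<Longrightarrow> 1 < l" "rc = Less \<Longrightarrow> l < n"
          using admissible_SharedBD[OF s[unfolded SharedB]] range SharedB by fastforce+
        have "M lc p l Less \<le> cost_bound (reduced_a lc p Less) (reduced_b lc l Less)"
          using SharedB range by (intro less) auto
        moreover have "M Greater (m - p) (n - l + 1) rc \<le>
            cost_bound (reduced_a Greater (m - p) rc) (reduced_b Greater (n - l + 1) rc)"
          using SharedB range by (intro less) auto
        moreover have "cost_bound (reduced_a lc p Less) (reduced_b lc l Less) +
            cost_bound (reduced_a Greater (m - p) rc) (reduced_b Greater (n - l + 1) rc) < cost_bound ?m ?n"
        proof (rule cost_bound_split[OF pos])
          show "reduced_a lc p Less + reduced_a Greater (m - p) rc \<le> ?m"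
            using edges range SharedB unfolding reduced_a_def by (auto simp: of_bool_def)
          show "reduced_b lc l Less + reduced_b Greater (n - l + 1) rc \<le> ?n"
            using edges range SharedB unfolding reduced_b_def by (auto simp: of_bool_def)
          \<comment> \<open>Deleting the shared \<open>b\<close> from the lower part turns
            \<open>l < j\<close> into a reduced size below \<open>c\<close>, and
            \<open>j < l\<close> into one of at least \<open>c\<close>.\<close>
          show "1 \<le> reduced_a lc p Less \<and> reduced_b lc l Less < min ?n 2 \<or>
              reduced_a lc p Less = 0 \<and> min ?n 2 \<le> reduced_b lc l Less"
            using edges sep c SharedB unfolding i_def j_def c_def[symmetric]
            by (auto simp: reduced_a_def reduced_b_def of_bool_def split: if_splits)
        qed
        ultimately show ?thesis using SharedB by simp
      qed
    qed
  qed
qed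

theorem theorem5:
  fixes k t :: nat
  assumes "k + t \<ge> 1"
  shows "M Free (5 * k) (9 * k + 12 * t) Free \<le> 14 * k + 11 * t - 2"
proof -
  have "M Free (5 * k) (9 * k + 12 * t) Free \<le> cost_bound (5 * k) (9 * k + 12 * t)"
    using M_le_cost_bound[of Free "5 * k" "9 * k + 12 * t" Free]
    by (simp add: reduced_a_def reduced_b_def)
  also have "\<dots> \<le> 12 * k + 6 * t"
    using assms unfolding cost_bound_def by auto
  \<comment> \<open>This amounts to \<open>2 * k + 5 * t \<ge> 2\<close>; the assumption also keeps
    the subtraction of 2 from truncating.\<close>
  also have "\<dots> \<le> 14 * k + 11 * t - 2"
    using assms by linarith
  finally show ?thesis .
qed

end
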